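(* Let $\mathcal{F}$ be a nonempty set of graphs. If the class of $\mathcal{F}$-free graphs has the CKS property, then $\mathcal{F}$ contains at least one star forest and at least one graph that is the complement of a star forest.
   Context: All graphs are finite, simple and undirected. A graph is $\mathcal{F}$-free if it contains no graph of $\mathcal{F}$ as an induced subgraph. For a graph class $\mathcal{P}$ and graph $G$, a set $U\subseteq V(G)$ is a maximal $\mathcal{P}$ set if $G[U]\in\mathcal{P}$ and no proper superset $U'$ of $U$ has $G[U']\in\mathcal{P}$. A graph class $\mathcal{P}$ has the CKS property if there is a polynomial $p$ such that every graph $G$ on $n$ vertices that has a maximal $\mathcal{P}$ set of size $n-1$ has at most $p(n)$ maximal $\mathcal{P}$ sets. For $s\ge 0$, an $s$-star is the complete bipartite graph $K_{1,s}$ (a single vertex counts as a star); a star forest is a graph every component of which is a star. The complement $\overline{G}$ of $G$ has vertex set $V(G)$ with two distinct vertices adjacent iff they are nonadjacent in $G$. *)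

theory Defs
  imports "Graph_Theory.Graph_Theory" "HOL-Computational_Algebra.Polynomial"
begin

text \<open>
  A finite simple undirected graph is a \<^locale>\<open>pair_graph\<close>: a finite loopfree symmetric digraph
  whose arcs are ordered pairs of vertices, so that an undirected edge \<open>{u, v}\<close> is the pair of arcs
  \<open>(u, v)\<close> and \<open>(v, u)\<close>. The graph without vertices is allowed; it is needed for \<open>G[U]\<close> to be a
  graph when \<open>U = {}\<close>.
\<close>

definition pair_induce :: "'a pair_pre_digraph \<Rightarrow> 'a set \<Rightarrow> 'a pair_pre_digraph" where
  "pair_induce G U = \<lparr>pverts = U, parcs = parcs G \<inter> U \<times> U\<rparr>"

lemma with_proj_pair_induce: "with_proj (pair_induce G U) = with_proj G \<restriction> U"
  by (auto simp: pair_induce_def with_proj_def induce_subgraph_def)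

definition pair_complement :: "'a pair_pre_digraph \<Rightarrow> 'a pair_pre_digraph" where
  "pair_complement G = \<lparr>pverts = pverts G,
     parcs = {(u, v). u \<in> pverts G \<and> v \<in> pverts G \<and> u \<noteq> v \<and> (u, v) \<notin> parcs G}\<rparr>"

text \<open>
  In a symmetric digraph the strongly connected components are the connected components of the
  underlying undirected graph.
\<close>

definition star_forest :: "'a pair_pre_digraph \<Rightarrow> bool" where
  "star_forest G \<longleftrightarrow> pair_graph G \<and>
     (\<forall>C \<in> pre_digraph.sccs (with_proj G). \<exists>s. complete_bipartite_digraph 1 s C)"

definition contains_induced :: "'a pair_pre_digraph \<Rightarrow> 'b pair_pre_digraph \<Rightarrow> bool" where
  "contains_induced G H \<longleftrightarrow>
     (\<exists>K. induced_subgraph K (with_proj G) \<and> digraph_iso (with_proj H) K)"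

definition free_graphs :: "'b pair_pre_digraph set \<Rightarrow> 'a pair_pre_digraph set" where
  "free_graphs \<F> = {G. pair_graph G \<and> (\<forall>H \<in> \<F>. \<not> contains_induced G H)}"

definition maximal_set :: "'a pair_pre_digraph set \<Rightarrow> 'a pair_pre_digraph \<Rightarrow> 'a set \<Rightarrow> bool" where
  "maximal_set \<P> G U \<longleftrightarrow> U \<subseteq> pverts G \<and> pair_induce G U \<in> \<P> \<and>
     \<not> (\<exists>U'. U \<subset> U' \<and> U' \<subseteq> pverts G \<and> pair_induce G U' \<in> \<P>)"

text \<open>
  The graphs have natural numbers as vertices, which covers all finite graphs up to isomorphism.
  The size \<open>n - 1\<close> is expressed without truncated subtraction.
\<close>

definition CKS_property :: "nat pair_pre_digraph set \<Rightarrow> bool" where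
  "CKS_property \<P> \<longleftrightarrow> (\<exists>p :: real poly. \<forall>G n. pair_graph G \<longrightarrow> card (pverts G) = n \<longrightarrow>
     (\<exists>U. maximal_set \<P> G U \<and> card U + 1 = n) \<longrightarrow>
     real (card {U. maximal_set \<P> G U}) \<le> poly p (real n))"

end

theory Submission
  imports Defs "HOL-Library.Multiset_Order"
begin

text \<open>
  Measure a graph by splitting it into mutually nonadjacent parts, deleting one vertex of each part,
  and recording the multiset of the multisets of sizes of the remaining pieces; induced subgraphs do
  not have larger measure, in the well-founded order on multisets of multisets.
  Let \<open>H \<in> \<F>\<close> have least measure. If \<open>H\<close> is not a star forest, then some part \<open>W\<close> with deleted vertex
  \<open>v\<close> has a piece \<open>D\<close> with two distinct vertices \<open>x\<close> and \<open>y\<close>. Take \<open>H\<close> with \<open>k\<close> copies of \<open>D\<close> in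
  place of one. Deleting \<open>v\<close>, or deleting \<open>x\<close> or \<open>y\<close> from every copy of \<open>D\<close>, decreases the measure,
  so it leaves an \<open>\<F>\<close>-free graph. The union of two different sets of the latter kind contains
  a whole copy of \<open>D\<close> and hence \<open>H\<close>, so the \<open>2 ^ k\<close> sets extend to different maximal sets.
  The second claim is the first one for the complements.
\<close>

section \<open>Induced embeddings\<close>

text \<open>The host is a relation and a vertex set, so a subset of the vertices with the same
  relation stands for the induced subgraph.\<close>

definition embeds :: "'b pair_pre_digraph \<Rightarrow> 'a rel \<Rightarrow> 'a set \<Rightarrow> bool" where
  "embeds H E U \<longleftrightarrow> (\<exists>f. inj_on f (pverts H) \<and> f ` pverts H \<subseteq> U \<and>
     (\<forall>u\<in>pverts H. \<forall>w\<in>pverts H. (u, w) \<in> parcs H \<longleftrightarrow> (f u, f w) \<in> E))"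

definition avoids :: "'b pair_pre_digraph set \<Rightarrow> 'a rel \<Rightarrow> 'a set \<Rightarrow> bool" where
  "avoids \<F> E U \<longleftrightarrow> (\<forall>H\<in>\<F>. \<not> embeds H E U)"

lemma embedsE:
  assumes "embeds H E U"
  obtains f where "inj_on f (pverts H)" "f ` pverts H \<subseteq> U"
    "\<forall>u\<in>pverts H. \<forall>w\<in>pverts H. (u, w) \<in> parcs H \<longleftrightarrow> (f u, f w) \<in> E"
  using assms unfolding embeds_def by (elim exE conjE) (rule that)

lemma embeds_mono: "embeds H E U \<Longrightarrow> U \<subseteq> U' \<Longrightarrow> embeds H E U'"
  unfolding embeds_def by (erule ex_forward) (auto intro: subset_trans)

lemma avoids_mono: "avoids \<F> E U' \<Longrightarrow> U \<subseteq> U' \<Longrightarrow> avoids \<F> E U"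
  unfolding avoids_def using embeds_mono by blast

text \<open>Arcs of \<open>with_proj\<close> are pairs, so an isomorphism onto an induced subgraph
  is determined by its vertex map; conversely, an embedding is an isomorphism onto the subgraph
  induced by its image.\<close>

lemma contains_induced_iff_embeds:
  assumes "pair_graph G" "pair_graph H"
  shows "contains_induced G H \<longleftrightarrow> embeds H (parcs G) (pverts G)"
proof
  interpret G: pair_graph G by fact
  interpret H: pair_graph H by fact
  show "embeds H (parcs G) (pverts G)" if "contains_induced G H"
  proof -
    obtain K h where K: "induced_subgraph K (with_proj G)"
      and iso: "pre_digraph.digraph_isomorphism (with_proj H) h"
      and eq: "K = app_iso h (with_proj H)"
      using \<open>contains_induced G H\<close> unfolding contains_induced_def digraph_iso_def by blast
    let ?f = "iso_verts h"
    have inj: "inj_on ?f (pverts H)"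
      and arc: "\<And>a. a \<in> parcs H \<Longrightarrow> ?f (fst a) = iso_tail h (iso_arcs h a) \<and>
                  ?f (snd a) = iso_head h (iso_arcs h a)"
      using iso unfolding pre_digraph.digraph_isomorphism_def by auto
    \<comment> \<open>\<open>K\<close> is compatible with \<open>with_proj G\<close>, so its tail
      and head functions are the projections, and being induced fixes its arc set.\<close>
    have tl: "iso_tail h = fst" "iso_head h = snd" and vK: "?f ` pverts H \<subseteq> pverts G"
      and aK: "iso_arcs h ` parcs H =
        {e \<in> parcs G. fst e \<in> ?f ` pverts H \<and> snd e \<in> ?f ` pverts H}"
      using K unfolding eq induced_subgraph_def subgraph_def compatible_def by auto
    have arc': "iso_arcs h a = (?f (fst a), ?f (snd a))" if "a \<in> parcs H" for a
      using arc[OF that] tl by (simp add: prod_eq_iff)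
    have "(u, w) \<in> parcs H \<longleftrightarrow> (?f u, ?f w) \<in> parcs G"
      if u: "u \<in> pverts H" and w: "w \<in> pverts H" for u w
    proof
      assume "(u, w) \<in> parcs H"
      moreover from this have "iso_arcs h (u, w) \<in> iso_arcs h ` parcs H" by (rule imageI)
      ultimately show "(?f u, ?f w) \<in> parcs G" using arc'[of "(u, w)"] unfolding aK by simp
    next
      assume "(?f u, ?f w) \<in> parcs G"
      then have "(?f u, ?f w) \<in> iso_arcs h ` parcs H" using aK u w by auto
      then obtain a where a: "a \<in> parcs H" "(?f u, ?f w) = iso_arcs h a" by blast
      moreover have "fst a \<in> pverts H" "snd a \<in> pverts H"
        using a(1) H.arc_fst_in_verts H.arc_snd_in_verts by auto
      ultimately have "fst a = u" "snd a = w" using arc'[OF a(1)] inj u w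
        by (auto dest: inj_onD)
      then show "(u, w) \<in> parcs H" using a(1) by auto
    qed
    with inj vK show ?thesis unfolding embeds_def by blast
  qed
  show "contains_induced G H" if "embeds H (parcs G) (pverts G)"
  proof -
    obtain f where inj: "inj_on f (pverts H)" and im: "f ` pverts H \<subseteq> pverts G"
      and ar: "\<And>u w. u \<in> pverts H \<Longrightarrow> w \<in> pverts H \<Longrightarrow>
                 (u, w) \<in> parcs H \<longleftrightarrow> (f u, f w) \<in> parcs G"
      using \<open>embeds H (parcs G) (pverts G)\<close> unfolding embeds_def by blast
    define h where "h = \<lparr>iso_verts = f, iso_arcs = map_prod f f, iso_head = snd, iso_tail = fst\<rparr>"
    have "parcs H \<subseteq> pverts H \<times> pverts H" using H.in_arcsD1 H.in_arcsD2 by auto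
    then have "inj_on (map_prod f f) (parcs H)"
      using map_prod_inj_on[OF inj inj] by (rule inj_on_subset[rotated])
    then have iso: "pre_digraph.digraph_isomorphism (with_proj H) h"
      using inj H.wf_digraph_axioms unfolding pre_digraph.digraph_isomorphism_def h_def by auto
    have "app_iso h (with_proj H) = with_proj G \<restriction> (f ` pverts H)"
    proof -
      have "map_prod f f ` parcs H = {e \<in> parcs G. fst e \<in> f ` pverts H \<and> snd e \<in> f ` pverts H}"
        (is "?L = ?R")
      proof
        show "?L \<subseteq> ?R"
        proof
          fix e assume "e \<in> ?L"
          then obtain u w where "(u, w) \<in> parcs H" "e = (f u, f w)" by auto
          then show "e \<in> ?R" using ar[of u w] H.in_arcsD1[of u w] H.in_arcsD2[of u w] by auto
        qed
        show "?R \<subseteq> ?L"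
        proof
          fix e assume "e \<in> ?R"
          then obtain u w where "u \<in> pverts H" "w \<in> pverts H" "e = (f u, f w)" "e \<in> parcs G"
            by (cases e) auto
          then have "(u, w) \<in> parcs H" "e = map_prod f f (u, w)" using ar[of u w] by auto
          then show "e \<in> ?L" by blast
        qed
      qed
      then show ?thesis unfolding app_iso_def induce_subgraph_def h_def by simp
    qed
    moreover have "induced_subgraph (with_proj G \<restriction> (f ` pverts H)) (with_proj G)"
      using im by (intro G.induced_induce) auto
    ultimately show ?thesis using iso unfolding contains_induced_def digraph_iso_def by metis
  qed
qed

lemma pair_graph_iff:
  "pair_graph G \<longleftrightarrow> finite (pverts G) \<and> parcs G \<subseteq> pverts G \<times> pverts G \<and> sym (parcs G) \<and> irrefl (parcs G)"
    (is "_ \<longleftrightarrow> ?R")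
proof
  assume "pair_graph G"
  then interpret pair_graph G .
  show ?R using pair_finite_verts pair_sym_arcs
    by (auto simp: symmetric_def irrefl_def dest: in_arcsD1 in_arcsD2 no_loops')
next
  assume ?R
  then have fin: "finite (pverts G)" and sub: "parcs G \<subseteq> pverts G \<times> pverts G"
    and "sym (parcs G)" "irrefl (parcs G)" by auto
  then show "pair_graph G"
    using finite_subset[OF sub]
    by unfold_locales (auto simp: symmetric_def irrefl_def)
qed

lemma pair_graph_pair_induce:
  "pair_graph G \<Longrightarrow> U \<subseteq> pverts G \<Longrightarrow> pair_graph (pair_induce G U)"
  unfolding pair_graph_iff pair_induce_def
  by (auto simp: irrefl_def sym_def intro: finite_subset)

lemma pair_induce_in_free_graphs:
  assumes "pair_graph G" "U \<subseteq> pverts G" "\<And>H. H \<in> \<F> \<Longrightarrow> pair_graph H"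
  shows "pair_induce G U \<in> free_graphs \<F> \<longleftrightarrow> avoids \<F> (parcs G) U"
proof -
  have "embeds H (parcs (pair_induce G U)) (pverts (pair_induce G U)) \<longleftrightarrow> embeds H (parcs G) U"
    for H :: "'b pair_pre_digraph"
    unfolding embeds_def pair_induce_def
    by (intro ex_cong1 conj_cong ball_cong refl) (auto simp: image_subset_iff)
  then show ?thesis
    using assms pair_graph_pair_induce[OF assms(1,2)]
    by (auto simp: free_graphs_def avoids_def contains_induced_iff_embeds)
qed

lemma maximal_set_iff_avoids:
  assumes "pair_graph G" "\<And>H. H \<in> \<F> \<Longrightarrow> pair_graph H"
  shows "maximal_set (free_graphs \<F>) G U \<longleftrightarrow> U \<subseteq> pverts G \<and> avoids \<F> (parcs G) U \<and>
     \<not> (\<exists>U'. U \<subset> U' \<and> U' \<subseteq> pverts G \<and> avoids \<F> (parcs G) U')"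
  unfolding maximal_set_def
  by (simp add: pair_induce_in_free_graphs[OF assms(1) _ assms(2)] cong: conj_cong)

section \<open>Complementary graphs\<close>

lemma pair_complement_complement: "pair_graph G \<Longrightarrow> pair_complement (pair_complement G) = G"
  unfolding pair_graph_iff pair_complement_def by (cases G) (auto simp: irrefl_def)

lemma pair_graph_complement: "pair_graph G \<Longrightarrow> pair_graph (pair_complement G)"
  unfolding pair_graph_iff pair_complement_def by (auto simp: irrefl_def sym_def)

text \<open>The same map works on both sides: it preserves distinctness by injectivity, and for
  \<open>u = w\<close> there are no loops to compare.\<close>

lemma embeds_complement:
  assumes "pair_graph G" "pair_graph H" "U \<subseteq> pverts G"
  shows "embeds (pair_complement H) (parcs (pair_complement G)) U \<longleftrightarrow> embeds H (parcs G) U"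
proof -
  have "irrefl (parcs G)" "irrefl (parcs H)" using assms by (auto simp: pair_graph_iff)
  have "(\<forall>u\<in>pverts H. \<forall>w\<in>pverts H. (u, w) \<in> parcs (pair_complement H) \<longleftrightarrow>
            (f u, f w) \<in> parcs (pair_complement G)) \<longleftrightarrow>
        (\<forall>u\<in>pverts H. \<forall>w\<in>pverts H. (u, w) \<in> parcs H \<longleftrightarrow> (f u, f w) \<in> parcs G)"
    if f: "inj_on f (pverts H)" "f ` pverts H \<subseteq> U" for f
  proof (intro ball_cong refl)
    fix u w assume uw: "u \<in> pverts H" "w \<in> pverts H"
    then have "f u \<in> pverts G" "f w \<in> pverts G" "f u = f w \<longleftrightarrow> u = w"
      using f assms(3) by (auto dest: inj_onD)
    then show "((u, w) \<in> parcs (pair_complement H) \<longleftrightarrow> (f u, f w) \<in> parcs (pair_complement G)) \<longleftrightarrow>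
        ((u, w) \<in> parcs H \<longleftrightarrow> (f u, f w) \<in> parcs G)"
      using uw \<open>irrefl (parcs G)\<close> \<open>irrefl (parcs H)\<close>
      by (auto simp: pair_complement_def irrefl_def)
  qed
  moreover have "pverts (pair_complement H) = pverts H" by (simp add: pair_complement_def)
  ultimately show ?thesis unfolding embeds_def by (simp cong: conj_cong)
qed

text \<open>The maximal sets of \<open>G\<close> for the complemented family are those of the
  complement of \<open>G\<close> for the original one. The number of vertices does not change, so
  the same polynomial serves.\<close>

lemma CKS_property_complement:
  fixes \<F> :: "'b pair_pre_digraph set"
  assumes pg: "\<And>H. H \<in> \<F> \<Longrightarrow> pair_graph H" and "CKS_property (free_graphs \<F>)"
  shows "CKS_property (free_graphs (pair_complement ` \<F>))"
proof -
  have max: "maximal_set (free_graphs (pair_complement ` \<F>)) G U \<longleftrightarrow>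
      maximal_set (free_graphs \<F>) (pair_complement G) U" if G: "pair_graph G" for G U
  proof -
    have pv: "pverts (pair_complement G) = pverts G" by (simp add: pair_complement_def)
    have "avoids (pair_complement ` \<F>) (parcs G) W \<longleftrightarrow> avoids \<F> (parcs (pair_complement G)) W"
      if "W \<subseteq> pverts G" for W
    proof -
      have "embeds (pair_complement H) (parcs G) W \<longleftrightarrow> embeds H (parcs (pair_complement G)) W"
        if "H \<in> \<F>" for H
        using embeds_complement[OF pair_graph_complement[OF G] pg[OF that], of W] \<open>W \<subseteq> pverts G\<close>
        by (simp add: pv pair_complement_complement[OF G])
      then show ?thesis by (simp add: avoids_def)
    qed
    moreover note pv
    moreover have "\<And>H. H \<in> pair_complement ` \<F> \<Longrightarrow> pair_graph H"
      using pg pair_graph_complement by blast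
    ultimately show ?thesis
      by (simp add: maximal_set_iff_avoids G pair_graph_complement pg cong: conj_cong)
  qed
  have pv: "pverts (pair_complement G) = pverts G" for G :: "nat pair_pre_digraph"
    by (simp add: pair_complement_def)
  obtain p :: "real poly" where p: "\<And>(G :: nat pair_pre_digraph) U. pair_graph G \<Longrightarrow>
      maximal_set (free_graphs \<F>) G U \<Longrightarrow> card U + 1 = card (pverts G) \<Longrightarrow>
      real (card {U. maximal_set (free_graphs \<F>) G U}) \<le> poly p (real (card (pverts G)))"
    using assms(2) unfolding CKS_property_def by blast
  show ?thesis
    unfolding CKS_property_def
    using p[OF pair_graph_complement] by (intro exI[of _ p] allI impI) (auto simp: max[THEN ext] pv)
qed

section \<open>A bound on pairwise incompatible families\<close>

lemma avoids_extends_to_maximal_set: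
  assumes "pair_graph G" "\<And>H. H \<in> \<F> \<Longrightarrow> pair_graph H" "A \<subseteq> pverts G" "avoids \<F> (parcs G) A"
  shows "\<exists>U. A \<subseteq> U \<and> maximal_set (free_graphs \<F>) G U"
proof -
  let ?S = "{U. A \<subseteq> U \<and> U \<subseteq> pverts G \<and> avoids \<F> (parcs G) U}"
  have "finite ?S" "?S \<noteq> {}" using assms by (auto simp: pair_graph_iff)
  then obtain U where U: "U \<in> ?S" "\<forall>U'\<in>?S. U \<subseteq> U' \<longrightarrow> U = U'"
    using finite_has_maximal[of ?S] by meson
  have "\<not> (\<exists>U'. U \<subset> U' \<and> U' \<subseteq> pverts G \<and> avoids \<F> (parcs G) U')"
  proof
    assume "\<exists>U'. U \<subset> U' \<and> U' \<subseteq> pverts G \<and> avoids \<F> (parcs G) U'"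
    then obtain U' where "U' \<in> ?S" "U \<subset> U'" using U(1) by blast
    with U(2) show False by blast
  qed
  with U(1) have "maximal_set (free_graphs \<F>) G U"
    by (simp add: maximal_set_iff_avoids[OF assms(1,2)])
  with U(1) show ?thesis by blast
qed

text \<open>A certificate for many maximal sets: no avoiding set includes two members of the
  family.\<close>

definition incompatible :: "'b pair_pre_digraph set \<Rightarrow> 'a rel \<Rightarrow> 'a set \<Rightarrow> 'a set set \<Rightarrow> bool" where
  "incompatible \<F> E V \<A> \<longleftrightarrow> \<A> \<subseteq> Pow V \<and> (\<forall>A\<in>\<A>. avoids \<F> E A) \<and>
     (\<forall>A\<in>\<A>. \<forall>B\<in>\<A>. A \<noteq> B \<longrightarrow> \<not> avoids \<F> E (A \<union> B))"

text \<open>The set \<open>pverts G - {v}\<close> is maximal because only the whole vertex set is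
  larger, so the CKS bound applies to \<open>G\<close>. Extending each member of \<A> to a maximal
  set is injective by incompatibility.\<close>

lemma CKS_property_bound:
  fixes \<F> :: "'b pair_pre_digraph set"
  assumes "CKS_property (free_graphs \<F>)" and pg: "\<And>H. H \<in> \<F> \<Longrightarrow> pair_graph H"
  shows "\<exists>p :: real poly. \<forall>(G :: nat pair_pre_digraph) v \<A>. pair_graph G \<longrightarrow> v \<in> pverts G \<longrightarrow>
      avoids \<F> (parcs G) (pverts G - {v}) \<longrightarrow> \<not> avoids \<F> (parcs G) (pverts G) \<longrightarrow>
      incompatible \<F> (parcs G) (pverts G) \<A> \<longrightarrow>
      real (card \<A>) \<le> poly p (real (card (pverts G)))"
proof -
  obtain p :: "real poly" where p: "\<And>(G :: nat pair_pre_digraph) U. pair_graph G \<Longrightarrow> maximal_set (free_graphs \<F>) G U \<Longrightarrow>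
      card U + 1 = card (pverts G) \<Longrightarrow>
      real (card {U. maximal_set (free_graphs \<F>) G U}) \<le> poly p (real (card (pverts G)))"
    using assms(1) unfolding CKS_property_def by blast
  show ?thesis
  proof (intro exI[of _ p] allI impI)
    fix G :: "nat pair_pre_digraph" and v \<A>
    assume G: "pair_graph G" and v: "v \<in> pverts G" and Gv: "avoids \<F> (parcs G) (pverts G - {v})"
      and nG: "\<not> avoids \<F> (parcs G) (pverts G)"
      and inc: "incompatible \<F> (parcs G) (pverts G) \<A>"
    have sub: "\<A> \<subseteq> Pow (pverts G)"
      and av: "\<And>A. A \<in> \<A> \<Longrightarrow> avoids \<F> (parcs G) A"
      and un: "\<And>A B. A \<in> \<A> \<Longrightarrow> B \<in> \<A> \<Longrightarrow> A \<noteq> B \<Longrightarrow> \<not> avoids \<F> (parcs G) (A \<union> B)"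
      using inc unfolding incompatible_def by blast+
    have fin: "finite (pverts G)" using G by (simp add: pair_graph_iff)
    let ?M = "{U. maximal_set (free_graphs \<F>) G U}"
    have max: "maximal_set (free_graphs \<F>) G U \<longleftrightarrow> U \<subseteq> pverts G \<and> avoids \<F> (parcs G) U \<and>
        \<not> (\<exists>U'. U \<subset> U' \<and> U' \<subseteq> pverts G \<and> avoids \<F> (parcs G) U')" for U
      using maximal_set_iff_avoids[OF G pg] .
    have "\<not> (\<exists>U'. pverts G - {v} \<subset> U' \<and> U' \<subseteq> pverts G \<and> avoids \<F> (parcs G) U')"
    proof
      assume "\<exists>U'. pverts G - {v} \<subset> U' \<and> U' \<subseteq> pverts G \<and> avoids \<F> (parcs G) U'"
      then obtain U' where U': "pverts G - {v} \<subset> U'" "U' \<subseteq> pverts G" "avoids \<F> (parcs G) U'"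
        by blast
      then have "U' = pverts G" by blast
      with U' nG show False by simp
    qed
    then have "maximal_set (free_graphs \<F>) G (pverts G - {v})" using Gv max by blast
    moreover have "card (pverts G - {v}) + 1 = card (pverts G)"
      using card_Suc_Diff1[OF fin v] by simp
    ultimately have bound: "real (card ?M) \<le> poly p (real (card (pverts G)))" using p G by blast
    have "\<exists>U. A \<subseteq> U \<and> U \<in> ?M" if "A \<in> \<A>" for A
      using avoids_extends_to_maximal_set[OF G pg _ av[OF that]] sub that by auto
    then obtain ext where ext: "\<And>A. A \<in> \<A> \<Longrightarrow> A \<subseteq> ext A \<and> ext A \<in> ?M" by metis
    have "inj_on ext \<A>"
    proof (rule inj_onI, rule ccontr)
      fix A B assume A: "A \<in> \<A>" and B: "B \<in> \<A>" and eq: "ext A = ext B" and ne: "A \<noteq> B"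
      have "A \<union> B \<subseteq> ext A" using ext[OF A] ext[OF B] eq by auto
      moreover have "avoids \<F> (parcs G) (ext A)" using ext[OF A] max by blast
      ultimately have "avoids \<F> (parcs G) (A \<union> B)" using avoids_mono by blast
      with un[OF A B ne] show False by contradiction
    qed
    moreover have "ext ` \<A> \<subseteq> ?M" using ext by blast
    moreover have "finite ?M"
      using fin max by (auto intro: finite_subset[of _ "Pow (pverts G)"])
    ultimately have "card \<A> \<le> card ?M" by (rule card_inj_on_le)
    with bound show "real (card \<A>) \<le> poly p (real (card (pverts G)))" by linarith
  qed
qed

section \<open>Transport of the bound to arbitrary vertex types\<close>

lemma embeds_image:
  assumes g: "inj_on g V" and U: "U \<subseteq> V"
  shows "embeds H (map_prod g g ` (E \<inter> V \<times> V)) (g ` U) \<longleftrightarrow> embeds H E U"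
proof -
  let ?E = "map_prod g g ` (E \<inter> V \<times> V)"
  have E: "(g a, g b) \<in> ?E \<longleftrightarrow> (a, b) \<in> E" if "a \<in> V" "b \<in> V" for a b
    using that g by (auto dest: inj_onD intro: rev_image_eqI)
  show ?thesis
  proof
    assume "embeds H E U"
    then obtain f where f: "inj_on f (pverts H)" "f ` pverts H \<subseteq> U"
      "\<forall>u\<in>pverts H. \<forall>w\<in>pverts H. (u, w) \<in> parcs H \<longleftrightarrow> (f u, f w) \<in> E"
      by (rule embedsE)
    have "inj_on (g \<circ> f) (pverts H)"
      using f(1,2) g U by (intro comp_inj_on) (auto intro: inj_on_subset)
    moreover have "(u, w) \<in> parcs H \<longleftrightarrow> ((g \<circ> f) u, (g \<circ> f) w) \<in> ?E"
      if "u \<in> pverts H" "w \<in> pverts H" for u w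
    proof -
      have "f u \<in> V" "f w \<in> V" using that f(2) U by auto
      then show ?thesis using E f(3)[rule_format, OF that] by simp
    qed
    moreover have "(g \<circ> f) ` pverts H \<subseteq> g ` U" using f(2) by auto
    ultimately show "embeds H ?E (g ` U)"
      unfolding embeds_def by (intro exI[of _ "g \<circ> f"] conjI ballI)
  next
    assume "embeds H ?E (g ` U)"
    then obtain f where f: "inj_on f (pverts H)" "f ` pverts H \<subseteq> g ` U"
      "\<forall>u\<in>pverts H. \<forall>w\<in>pverts H. (u, w) \<in> parcs H \<longleftrightarrow> (f u, f w) \<in> ?E"
      by (rule embedsE)
    have "\<forall>u\<in>pverts H. \<exists>a. a \<in> U \<and> g a = f u"
    proof
      fix u assume "u \<in> pverts H"
      then have "f u \<in> g ` U" using f(2) by (simp add: image_subset_iff)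
      then show "\<exists>a. a \<in> U \<and> g a = f u" by auto
    qed
    from bchoice[OF this] obtain f' where f': "\<And>u. u \<in> pverts H \<Longrightarrow> f' u \<in> U \<and> g (f' u) = f u"
      by auto
    have "inj_on f' (pverts H)"
    proof (rule inj_onI)
      fix u w assume "u \<in> pverts H" "w \<in> pverts H" "f' u = f' w"
      moreover from this have "f u = f w" using f'[of u] f'[of w] by simp
      ultimately show "u = w" using f(1) by (simp add: inj_on_def)
    qed
    moreover have "f' ` pverts H \<subseteq> U" using f' by blast
    moreover have "(u, w) \<in> parcs H \<longleftrightarrow> (f' u, f' w) \<in> E"
      if "u \<in> pverts H" "w \<in> pverts H" for u w
    proof -
      have "f' u \<in> V" "f' w \<in> V" using that f' U by auto
      then show ?thesis using E[of "f' u" "f' w"] f(3)[rule_format, OF that] f' that by simp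
    qed
    ultimately show "embeds H E U"
      unfolding embeds_def by (intro exI[of _ f'] conjI ballI)
  qed
qed

text \<open>\<open>CKS_property\<close> speaks of natural numbers as vertices, while the
  construction has pairs; numbering the finite set \<open>V\<close> transfers the bound.\<close>

lemma CKS_property_bound_any_type:
  fixes \<F> :: "'b pair_pre_digraph set"
  assumes "CKS_property (free_graphs \<F>)" and pg: "\<And>H. H \<in> \<F> \<Longrightarrow> pair_graph H"
  shows "\<exists>p :: real poly. \<forall>(V :: 'a set) E v \<A>. finite V \<longrightarrow> sym E \<longrightarrow> irrefl E \<longrightarrow> v \<in> V \<longrightarrow>
      avoids \<F> E (V - {v}) \<longrightarrow> \<not> avoids \<F> E V \<longrightarrow> incompatible \<F> E V \<A> \<longrightarrow>
      real (card \<A>) \<le> poly p (real (card V))"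
proof -
  obtain p :: "real poly" where p:
    "\<And>G v \<A>. pair_graph (G :: nat pair_pre_digraph) \<Longrightarrow> v \<in> pverts G \<Longrightarrow>
      avoids \<F> (parcs G) (pverts G - {v}) \<Longrightarrow> \<not> avoids \<F> (parcs G) (pverts G) \<Longrightarrow>
      incompatible \<F> (parcs G) (pverts G) \<A> \<Longrightarrow>
      real (card \<A>) \<le> poly p (real (card (pverts G)))"
    using CKS_property_bound[OF assms] by blast
  show ?thesis
  proof (intro exI[of _ p] allI impI)
    fix V :: "'a set" and E v \<A>
    assume fin: "finite V" and sym: "sym E" and irr: "irrefl E" and v: "v \<in> V"
      and Vv: "avoids \<F> E (V - {v})" and nV: "\<not> avoids \<F> E V" and inc: "incompatible \<F> E V \<A>"
    have sub: "\<A> \<subseteq> Pow V"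
      and av: "\<And>A. A \<in> \<A> \<Longrightarrow> avoids \<F> E A"
      and un: "\<And>A B. A \<in> \<A> \<Longrightarrow> B \<in> \<A> \<Longrightarrow> A \<noteq> B \<Longrightarrow> \<not> avoids \<F> E (A \<union> B)"
      using inc unfolding incompatible_def by blast+
    obtain g :: "'a \<Rightarrow> nat" where g: "inj_on g V"
      using finite_imp_inj_to_nat_seg[OF fin] by blast
    define G where "G = \<lparr>pverts = g ` V, parcs = map_prod g g ` (E \<inter> V \<times> V)\<rparr>"
    have G_avoids: "avoids \<F> (parcs G) (g ` U) \<longleftrightarrow> avoids \<F> E U" if "U \<subseteq> V" for U
      by (simp add: avoids_def G_def embeds_image[OF g that])
    have pgG: "pair_graph G"
    proof -
      have "(b, a) \<in> parcs G" if "(a, b) \<in> parcs G" for a b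
      proof -
        obtain c d where cd: "(c, d) \<in> E \<inter> V \<times> V" "a = g c" "b = g d"
          using \<open>(a, b) \<in> parcs G\<close> by (auto simp: G_def)
        then have "(d, c) \<in> E \<inter> V \<times> V" using sym by (auto dest: symD)
        then have "map_prod g g (d, c) \<in> parcs G"
          unfolding G_def pair_pre_digraph.simps by (rule imageI)
        then show ?thesis using cd by simp
      qed
      moreover have "(a, a) \<notin> parcs G" for a
      proof
        assume "(a, a) \<in> parcs G"
        then obtain c d where cd: "(c, d) \<in> E" "c \<in> V" "d \<in> V" "g c = g d"
          by (auto simp: G_def)
        then have "c = d" using g by (auto dest: inj_onD)
        with cd(1) irr show False by (auto simp: irrefl_def)
      qed
      moreover have "finite (pverts G)" "parcs G \<subseteq> pverts G \<times> pverts G"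
        using fin by (auto simp: G_def)
      ultimately show ?thesis unfolding pair_graph_iff by (auto simp: irrefl_def intro: symI)
    qed
    have gv: "pverts G - {g v} = g ` (V - {v})"
      using g v by (auto simp: G_def dest: inj_onD)
    have inj: "inj_on ((`) g) \<A>"
      using inj_on_image_Pow[OF g] sub by (rule inj_on_subset)
    have "real (card ((`) g ` \<A>)) \<le> poly p (real (card (pverts G)))"
    proof (rule p[OF pgG, of "g v"])
      show "g v \<in> pverts G" using v by (simp add: G_def)
      show "avoids \<F> (parcs G) (pverts G - {g v})" using Vv by (simp add: gv G_avoids)
      show "\<not> avoids \<F> (parcs G) (pverts G)" using nV G_avoids[of V] by (simp add: G_def)
      show "incompatible \<F> (parcs G) (pverts G) ((`) g ` \<A>)"
        unfolding incompatible_def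
      proof (intro conjI ballI impI)
        show "(`) g ` \<A> \<subseteq> Pow (pverts G)" using sub by (auto simp: G_def)
        show "avoids \<F> (parcs G) A" if "A \<in> (`) g ` \<A>" for A
          using that av G_avoids sub by auto
        fix A B assume AB: "A \<in> (`) g ` \<A>" "B \<in> (`) g ` \<A>" "A \<noteq> B"
        then obtain A' B' where *: "A' \<in> \<A>" "B' \<in> \<A>" "A = g ` A'" "B = g ` B'" by blast
        then have "\<not> avoids \<F> E (A' \<union> B')" "A' \<union> B' \<subseteq> V" using AB(3) un sub by auto
        then show "\<not> avoids \<F> (parcs G) (A \<union> B)"
          using G_avoids[of "A' \<union> B'"] *(3,4) by (simp add: image_Un)
      qed
    qed
    moreover have "card (pverts G) = card V" using card_image[OF g] by (simp add: G_def)
    ultimately show "real (card \<A>) \<le> poly p (real (card V))" by (simp add: card_image[OF inj])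
  qed
qed

section \<open>Covers by parts\<close>

text \<open>The two sets may overlap: parts and pieces form covers rather than partitions, and
  \<open>nonadj E A A\<close> says that \<open>A\<close> is independent.\<close>

definition nonadj :: "'a rel \<Rightarrow> 'a set \<Rightarrow> 'a set \<Rightarrow> bool" where
  "nonadj E A B \<longleftrightarrow> (\<forall>a\<in>A. \<forall>b\<in>B. (a, b) \<notin> E \<and> (b, a) \<notin> E)"

text \<open>
  The numbers only bound the sizes of the pieces, and \<open>v\<close> need not belong to \<open>W\<close>, so that
  both notions pass to subsets with the same multiset.
\<close>

inductive pieces :: "'a rel \<Rightarrow> 'a set \<Rightarrow> nat multiset \<Rightarrow> bool" for E where
  empty: "pieces E {} {#}"
| add: "pieces E U N \<Longrightarrow> finite D \<Longrightarrow> card D \<le> n \<Longrightarrow> nonadj E U D \<Longrightarrow>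
    pieces E (U \<union> D) (add_mset n N)"

inductive centred_parts :: "'a rel \<Rightarrow> 'a set \<Rightarrow> nat multiset multiset \<Rightarrow> bool" for E where
  empty: "centred_parts E {} {#}"
| add: "centred_parts E V M \<Longrightarrow> pieces E (W - {v}) N \<Longrightarrow> nonadj E V W \<Longrightarrow>
    centred_parts E (V \<union> W) (add_mset N M)"

text \<open>Preimages of pieces are pieces: arcs map forward, so nonadjacency pulls back, and
  injectivity bounds the sizes. This handles inclusions, induced embeddings and the projection
  \<open>fst\<close> alike.\<close>

lemma pieces_pullback:
  assumes "pieces E V N" "inj_on h U" "h ` U \<subseteq> V"
    "\<And>a b. a \<in> U \<Longrightarrow> b \<in> U \<Longrightarrow> (a, b) \<in> E' \<Longrightarrow> (h a, h b) \<in> E"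
  shows "pieces E' U N"
  using assms
proof (induction arbitrary: U rule: pieces.induct)
  case empty
  then show ?case by (auto intro: pieces.empty)
next
  case (add V N D n)
  let ?A = "{a \<in> U. h a \<in> V}" and ?B = "{a \<in> U. h a \<in> D}"
  have inj: "inj_on h ?A" "inj_on h ?B" using add.prems(1) by (auto intro: inj_on_subset)
  have "pieces E' ?A N" using inj(1) add.prems(3) by (intro add.IH) auto
  moreover have "finite ?B" using add.hyps(2) inj(2) by (rule_tac inj_on_finite[of h]) auto
  moreover have "card ?B \<le> n"
    using card_inj_on_le[OF inj(2) _ add.hyps(2)] add.hyps(3) by fastforce
  moreover have "nonadj E' ?A ?B"
    using add.hyps(4) add.prems(3) unfolding nonadj_def by blast
  ultimately have "pieces E' (?A \<union> ?B) (add_mset n N)" by (rule pieces.add)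
  moreover have "?A \<union> ?B = U" using add.prems(2) by auto
  ultimately show ?case by simp
qed

lemma centred_parts_pullback:
  assumes "centred_parts E V M" "inj_on h U" "h ` U \<subseteq> V"
    "\<And>a b. a \<in> U \<Longrightarrow> b \<in> U \<Longrightarrow> (a, b) \<in> E' \<Longrightarrow> (h a, h b) \<in> E"
  shows "centred_parts E' U M"
  using assms
proof (induction arbitrary: U rule: centred_parts.induct)
  case empty
  then show ?case by (auto intro: centred_parts.empty)
next
  case (add V M W v N)
  let ?A = "{a \<in> U. h a \<in> V}" and ?B = "{a \<in> U. h a \<in> W}"
  have inj: "inj_on h ?A" "inj_on h ?B" using add.prems(1) by (auto intro: inj_on_subset)
  have A: "centred_parts E' ?A M" using inj(1) add.prems(3) by (intro add.IH) auto
  \<comment> \<open>At most one vertex of \<open>?B\<close> is mapped to \<open>v\<close>; it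
    becomes the new deleted vertex. If there is none, any \<open>v'\<close> will do.\<close>
  obtain v' where v': "\<And>a. a \<in> ?B \<Longrightarrow> h a = v \<Longrightarrow> a = v'"
    using inj(2) unfolding inj_on_def by (metis (no_types, lifting))
  have "pieces E' (?B - {v'}) N"
  proof (rule pieces_pullback[OF add.hyps(2), where h = h])
    show "inj_on h (?B - {v'})" using inj(2) by (rule inj_on_subset) auto
    show "h ` (?B - {v'}) \<subseteq> W - {v}" using v' by blast
    show "(h a, h b) \<in> E" if "a \<in> ?B - {v'}" "b \<in> ?B - {v'}" "(a, b) \<in> E'" for a b
      using add.prems(3) that by blast
  qed
  moreover have "nonadj E' ?A ?B"
    using add.hyps(3) add.prems(3) unfolding nonadj_def by blast
  ultimately have "centred_parts E' (?A \<union> ?B) (add_mset N M)"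
    using A by (intro centred_parts.add)
  moreover have "?A \<union> ?B = U" using add.prems(2) by auto
  ultimately show ?case by simp
qed

text \<open>No arc runs between different pieces, so both ends of an arc share a piece. That piece
  is moved to the outermost step of the cover.\<close>

lemma pieces_split_edge:
  assumes "pieces E U N" "x \<in> U" "y \<in> U" "(x, y) \<in> E"
  obtains U' D n N' where "U = U' \<union> D" "x \<in> D" "y \<in> D" "N = add_mset n N'" "pieces E U' N'"
    "finite D" "card D \<le> n" "nonadj E U' D"
  using assms
proof (induction arbitrary: thesis rule: pieces.induct)
  case empty
  then show ?case by simp
next
  case (add U N D n)
  consider "x \<in> D" "y \<in> D" | "x \<in> U" "y \<in> U"
    using add.prems(2-4) add.hyps(4) unfolding nonadj_def by blast
  then show ?case
  proof cases
    case 1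
    then show ?thesis using add.prems(1) add.hyps by blast
  next
    case 2
    then obtain U' D' n' N' where *: "U = U' \<union> D'" "x \<in> D'" "y \<in> D'" "N = add_mset n' N'"
      "pieces E U' N'" "finite D'" "card D' \<le> n'" "nonadj E U' D'"
      using add.IH add.prems(4) by blast
    \<comment> \<open>Pieces can be added in any order: \<open>D\<close> now precedes
      \<open>D'\<close>.\<close>
    have "pieces E (U' \<union> D) (add_mset n N')"
      using *(1,5) add.hyps unfolding nonadj_def by (intro pieces.add) (auto simp: nonadj_def)
    moreover have "nonadj E (U' \<union> D) D'" using * add.hyps(4) unfolding nonadj_def by blast
    ultimately show ?thesis using add.prems(1)[of "U' \<union> D" D' n' "add_mset n N'"] * by auto
  qed
qed

text \<open>Either some part keeps an arc after its deleted vertex is gone, or every connected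
  subset lies in one part and loses all arcs with one vertex. Connectedness is phrased as having no
  nontrivial split into nonadjacent sets.\<close>

lemma centred_parts_cases:
  assumes "centred_parts E V M"
  obtains (edge) V' W v N M' x y where "V = V' \<union> W" "M = add_mset N M'" "centred_parts E V' M'"
      "pieces E (W - {v}) N" "nonadj E V' W" "x \<in> W - {v}" "y \<in> W - {v}" "(x, y) \<in> E"
  | (starry) "\<And>C. C \<subseteq> V \<Longrightarrow> (\<And>A B. C = A \<union> B \<Longrightarrow> A \<inter> B = {} \<Longrightarrow> nonadj E A B \<Longrightarrow> A = {} \<or> B = {}) \<Longrightarrow>
      \<exists>v. nonadj E (C - {v}) (C - {v})"
  using assms
proof (induction arbitrary: thesis rule: centred_parts.induct)
  case empty
  then show ?case by (auto simp: nonadj_def)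
next
  case (add V M W v N)
  note edge = add.prems(1) and starry = add.prems(2)
  show ?case
  proof (cases "nonadj E (W - {v}) (W - {v})")
    case False
    then obtain x y where "x \<in> W - {v}" "y \<in> W - {v}" "(x, y) \<in> E"
      unfolding nonadj_def by blast
    then show ?thesis using edge add.hyps by blast
  next
    case W: True
    show ?thesis
    proof (rule add.IH)
      fix V' W' v' N' M' x y
      assume *: "V = V' \<union> W'" "M = add_mset N' M'" "centred_parts E V' M'"
        "pieces E (W' - {v'}) N'" "nonadj E V' W'" "x \<in> W' - {v'}" "y \<in> W' - {v'}" "(x, y) \<in> E"
      have "centred_parts E (V' \<union> W) (add_mset N M')"
        using * add.hyps by (intro centred_parts.add) (auto simp: nonadj_def)
      moreover have "nonadj E (V' \<union> W) W'"
        using * add.hyps(3) unfolding nonadj_def by blast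
      ultimately show ?thesis using edge[of "V' \<union> W" W' N' "add_mset N M'" v' x y] *
        by (auto simp: ac_simps)
    next
      assume IH: "\<And>C. C \<subseteq> V \<Longrightarrow> (\<And>A B. C = A \<union> B \<Longrightarrow> A \<inter> B = {} \<Longrightarrow> nonadj E A B \<Longrightarrow> A = {} \<or> B = {}) \<Longrightarrow>
        \<exists>v. nonadj E (C - {v}) (C - {v})"
      show ?thesis
      proof (rule starry)
        fix C assume C: "C \<subseteq> V \<union> W"
          and conn: "\<And>A B. C = A \<union> B \<Longrightarrow> A \<inter> B = {} \<Longrightarrow> nonadj E A B \<Longrightarrow> A = {} \<or> B = {}"
        \<comment> \<open>The remainder \<open>C - V\<close> lies in \<open>W\<close>, so no arc
          crosses this split; a connected \<open>C\<close> therefore lies in \<open>W\<close> or in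
          \<open>V\<close>.\<close>
        have "C = (C \<inter> V) \<union> (C - V)" "(C \<inter> V) \<inter> (C - V) = {}" "nonadj E (C \<inter> V) (C - V)"
          using C add.hyps(3) unfolding nonadj_def by auto
        from conn[OF this] have "C \<subseteq> W \<or> C \<subseteq> V" using C by blast
        then show "\<exists>v. nonadj E (C - {v}) (C - {v})"
        proof
          assume "C \<subseteq> W"
          then show ?thesis using W unfolding nonadj_def by blast
        next
          assume "C \<subseteq> V"
          then show ?thesis using IH conn by blast
        qed
      qed
    qed
  qed
qed


section \<open>Assembling covers from families of copies\<close>

lemma pieces_Un_copies:
  assumes "pieces E U N" "finite K"
    and "\<And>i. i \<in> K \<Longrightarrow> finite (Z i)" "\<And>i. i \<in> K \<Longrightarrow> card (Z i) \<le> n"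
    and "\<And>i. i \<in> K \<Longrightarrow> nonadj E U (Z i)"
    and "\<And>i j. i \<in> K \<Longrightarrow> j \<in> K \<Longrightarrow> i \<noteq> j \<Longrightarrow> nonadj E (Z i) (Z j)"
  shows "pieces E (U \<union> (\<Union>i\<in>K. Z i)) (N + replicate_mset (card K) n)"
  using assms(2-)
proof (induction K rule: finite_induct)
  case empty
  then show ?case using assms(1) by simp
next
  case (insert i K)
  have "nonadj E (U \<union> (\<Union>i\<in>K. Z i)) (Z i)"
    using insert.prems(3)[of i] insert.prems(4)[of _ i] insert.hyps(2)
    unfolding nonadj_def by blast
  then have "pieces E ((U \<union> (\<Union>i\<in>K. Z i)) \<union> Z i) (add_mset n (N + replicate_mset (card K) n))"
    using insert by (intro pieces.add) auto
  then show ?case using insert.hyps by (simp add: ac_simps)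
qed

lemma centred_parts_Un_copies:
  assumes "centred_parts E V M" "finite K"
    and "\<And>i. i \<in> K \<Longrightarrow> pieces E (Z i - {c i}) N"
    and "\<And>i. i \<in> K \<Longrightarrow> nonadj E V (Z i)"
    and "\<And>i j. i \<in> K \<Longrightarrow> j \<in> K \<Longrightarrow> i \<noteq> j \<Longrightarrow> nonadj E (Z i) (Z j)"
  shows "centred_parts E (V \<union> (\<Union>i\<in>K. Z i)) (M + replicate_mset (card K) N)"
  using assms(2-)
proof (induction K rule: finite_induct)
  case empty
  then show ?case using assms(1) by simp
next
  case (insert i K)
  have "nonadj E (V \<union> (\<Union>i\<in>K. Z i)) (Z i)"
    using insert.prems(2)[of i] insert.prems(3)[of _ i] insert.hyps(2)
    unfolding nonadj_def by blast
  then have "centred_parts E ((V \<union> (\<Union>i\<in>K. Z i)) \<union> Z i) (add_mset N (M + replicate_mset (card K) N))"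
    using insert by (intro centred_parts.add) auto
  then show ?case using insert.hyps by (simp add: ac_simps)
qed

lemma pieces_single: "finite D \<Longrightarrow> card D \<le> n \<Longrightarrow> pieces E D {#n#}"
  using pieces.add[OF pieces.empty, of D n E] by (simp add: nonadj_def)

lemma pieces_subset: "pieces E V N \<Longrightarrow> U \<subseteq> V \<Longrightarrow> pieces E U N"
  by (rule pieces_pullback[where h = id]) auto

lemma centred_parts_subset: "centred_parts E V M \<Longrightarrow> U \<subseteq> V \<Longrightarrow> centred_parts E U M"
  by (rule centred_parts_pullback[where h = id]) auto

text \<open>Monotonicity of the measure, the source of the avoidance claims in the construction: a
  host with a cover of too small a measure cannot contain a member of the family.\<close>

lemma centred_parts_embeds:
  assumes "centred_parts E U M" "embeds H E U"
  shows "centred_parts (parcs H) (pverts H) M"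
proof -
  obtain f where f: "inj_on f (pverts H)" "f ` pverts H \<subseteq> U"
    "\<forall>u\<in>pverts H. \<forall>w\<in>pverts H. (u, w) \<in> parcs H \<longleftrightarrow> (f u, f w) \<in> E"
    using assms(2) by (rule embedsE)
  show ?thesis by (rule centred_parts_pullback[OF assms(1) f(1,2)]) (use f(3) in blast)
qed

text \<open>Gives every finite graph a measure, so that a least one exists. The whole set is one
  part, and removing the arbitrary vertex \<open>undefined\<close> cannot increase its size.\<close>

lemma centred_parts_trivial: "finite V \<Longrightarrow> centred_parts E V {#{#card V#}#}"
  using centred_parts.add[OF centred_parts.empty pieces_single, of V undefined "card V" E]
  by (simp add: nonadj_def card_Diff1_le)

section \<open>Star forests\<close>

text \<open>In a component, deleting \<open>v\<close> leaves an independent set, while connectedness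
  makes every other vertex adjacent to \<open>v\<close>; hence the component is a star with centre
  \<open>v\<close>.\<close>

lemma star_forestI:
  assumes H: "pair_graph H"
    and star: "\<And>C. C \<subseteq> pverts H \<Longrightarrow>
      (\<And>A B. C = A \<union> B \<Longrightarrow> A \<inter> B = {} \<Longrightarrow> nonadj (parcs H) A B \<Longrightarrow> A = {} \<or> B = {}) \<Longrightarrow>
      \<exists>v. nonadj (parcs H) (C - {v}) (C - {v})"
  shows "star_forest H"
  unfolding star_forest_def
proof (intro conjI ballI)
  fix K assume "K \<in> pre_digraph.sccs (with_proj H)"
  then have ind: "induced_subgraph K (with_proj H)" and conn: "strongly_connected K"
    by (auto simp: pre_digraph.sccs_def)
  let ?E = "parcs H" and ?C = "verts K"
  have C: "?C \<subseteq> pverts H" and K: "K = with_proj (pair_induce H ?C)"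
    using ind unfolding induced_subgraph_def subgraph_def compatible_def with_proj_def
    by (auto simp: pair_induce_def intro!: pre_digraph.equality)
  have ends: "arcs_ends K = ?E \<inter> ?C \<times> ?C" by (subst K) (simp add: pair_induce_def)
  have sym: "sym ?E" and irr: "irrefl ?E" using H by (auto simp: pair_graph_iff)
  have unsep: "A = {} \<or> B = {}" if AB: "?C = A \<union> B" "A \<inter> B = {}" "nonadj ?E A B" for A B
  proof (rule ccontr)
    assume "\<not> (A = {} \<or> B = {})"
    then obtain a b where a: "a \<in> A" and b: "b \<in> B" by blast
    have "(a, b) \<in> rtrancl_on ?C (arcs_ends K)"
      using conn a b AB(1) unfolding strongly_connected_def reachable_def by blast
    \<comment> \<open>A path from \<open>a\<close> stays in \<open>A\<close>, because no arc leads
      from \<open>A\<close> to \<open>B\<close>.\<close>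
    then have "b \<in> A"
    proof (induction rule: rtrancl_on_induct)
      case base
      show ?case by (rule a)
    next
      case (step u w)
      then show ?case using AB unfolding ends nonadj_def by blast
    qed
    with b AB(2) show False by blast
  qed
  obtain v where v: "v \<in> ?C" "nonadj ?E (?C - {v}) (?C - {v})"
  proof -
    obtain v where v: "nonadj ?E (?C - {v}) (?C - {v})" using star[OF C unsep] by blast
    obtain c where "c \<in> ?C" using conn unfolding strongly_connected_def by blast
    show thesis
    proof (cases "v \<in> ?C")
      case True
      then show thesis using v by (rule that)
    next
      case False
      \<comment> \<open>With \<open>v\<close> outside the component, the whole component is
        independent, so any of its vertices can be the centre.\<close>
      then have "nonadj ?E (?C - {c}) (?C - {c})" using v unfolding nonadj_def by blast
      with \<open>c \<in> ?C\<close> show thesis by (rule that)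
    qed
  qed
  have adj: "(u, v) \<in> ?E" "(v, u) \<in> ?E" if u: "u \<in> ?C" "u \<noteq> v" for u
  proof -
    \<comment> \<open>The singleton \<open>{u}\<close> cannot be split off, so \<open>u\<close> has
      a neighbour, and independence of \<open>?C - {v}\<close> leaves only \<open>v\<close>.\<close>
    have "\<not> nonadj ?E {u} (?C - {u})" using unsep[of "{u}" "?C - {u}"] u v(1) by auto
    then obtain b where b: "b \<in> ?C" "b \<noteq> u" "(u, b) \<in> ?E \<or> (b, u) \<in> ?E"
      unfolding nonadj_def by blast
    then have "b = v" using v(2) u unfolding nonadj_def by blast
    with b(3) sym show "(u, v) \<in> ?E" "(v, u) \<in> ?E" by (auto dest: symD)
  qed
  have "arcs_ends K = {v} \<times> (?C - {v}) \<union> (?C - {v}) \<times> {v}"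
    using adj v irr unfolding ends nonadj_def irrefl_def by blast
  moreover have "?C = {v} \<union> (?C - {v})" "{v} \<inter> (?C - {v}) = {}" "card {v} = 1" using v(1) by auto
  moreover have "graph K"
  proof -
    interpret pair_graph "pair_induce H ?C" using H C by (rule pair_graph_pair_induce)
    have "graph (with_proj (pair_induce H ?C))" by unfold_locales
    then show ?thesis by (simp flip: K)
  qed
  ultimately show "\<exists>s. complete_bipartite_digraph 1 s K"
    unfolding complete_bipartite_digraph_def by blast
qed (rule H)

section \<open>The construction\<close>

lemma poly_over_power_tendsto_0:
  fixes p :: "real poly"
  assumes "c > 1"
  shows "(\<lambda>k. poly p (real k) / c ^ k) \<longlonglongrightarrow> 0"
  using assms
proof (induction p arbitrary: c)
  case 0
  then show ?case by simp
next
  case (pCons a p)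
  \<comment> \<open>The denominator is split as \<open>c ^ k = s ^ k * s ^ k\<close>: one factor
    absorbs the new factor \<open>k\<close>, the other goes to the induction hypothesis, which
    covers every base above 1.\<close>
  define s where "s = sqrt c"
  have s: "s > 1" "c = s * s" using pCons.prems by (auto simp: s_def)
  have "(\<lambda>k. real k / s ^ k) \<longlonglongrightarrow> 0" using lim_n_over_pown[of s] s(1) by simp
  from tendsto_mult[OF this pCons.IH[OF s(1)]]
  have "(\<lambda>k. real k / s ^ k * (poly p (real k) / s ^ k)) \<longlonglongrightarrow> 0" by simp
  moreover have "(\<lambda>k. a * (1 / c) ^ k) \<longlonglongrightarrow> a * 0"
    using pCons.prems by (intro tendsto_mult tendsto_const LIMSEQ_realpow_zero) auto
  ultimately have "(\<lambda>k. a * (1 / c) ^ k + real k / s ^ k * (poly p (real k) / s ^ k)) \<longlonglongrightarrow> 0"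
    using tendsto_add by fastforce
  moreover have "poly (pCons a p) (real k) / c ^ k =
      a * (1 / c) ^ k + real k / s ^ k * (poly p (real k) / s ^ k)" for k
    by (simp add: s(2) power_mult_distrib add_divide_distrib power_one_over)
  ultimately show ?case by simp
qed

text \<open>The argument of \<open>p\<close> will be the size of a host with \<open>k\<close>
  copies, and \<open>k \<ge> 1\<close> ensures that a copy is present. Composing \<open>p\<close>
  with a linear polynomial gives a polynomial in \<open>k\<close>.\<close>

lemma ex_poly_less_power2:
  fixes p :: "real poly" and a d :: nat
  shows "\<exists>k\<ge>1. poly p (real (a + k * d)) < 2 ^ k"
proof -
  have "(\<lambda>k. poly (pcompose p [:real a, real d:]) (real k) / 2 ^ k) \<longlonglongrightarrow> 0"
    by (rule poly_over_power_tendsto_0) simp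
  then have "eventually (\<lambda>k. poly (pcompose p [:real a, real d:]) (real k) / 2 ^ k < 1) sequentially"
    by (rule order_tendstoD) simp
  then obtain k0 where "\<And>k. k \<ge> k0 \<Longrightarrow> poly (pcompose p [:real a, real d:]) (real k) / 2 ^ k < 1"
    unfolding eventually_sequentially by blast
  from this[of "max k0 1"] show ?thesis
    by (intro exI[of _ "max k0 1"]) (simp add: poly_pcompose)
qed


text \<open>The feature of the multiset order on which the measure rests: one element outweighs any
  number of smaller ones, so the number of copies is free.\<close>

lemma replicate_mset_less_single: "a < b \<Longrightarrow> replicate_mset k a < {#b#}" for a b :: "'a :: linorder"
  by (simp add: in_replicate_mset)

text \<open>\<open>W\<close> is the part with an arc left after deleting \<open>v\<close>,
  \<open>V\<close> collects the other parts, and \<open>add_mset N M\<close> is the least measure.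
  The contradiction is between a host of size linear in \<open>k\<close> and exponentially many
  maximal sets.\<close>

lemma minimal_not_star_forest_False:
  fixes \<F> :: "'a pair_pre_digraph set"
  assumes pg: "\<And>H. H \<in> \<F> \<Longrightarrow> pair_graph H" and CKS: "CKS_property (free_graphs \<F>)"
    and H: "H \<in> \<F>"
    and least: "\<And>H' M'. H' \<in> \<F> \<Longrightarrow> centred_parts (parcs H') (pverts H') M' \<Longrightarrow>
      \<not> M' < add_mset N M"
    and V: "pverts H = V \<union> W" "centred_parts (parcs H) V M" "pieces (parcs H) (W - {v}) N"
      "nonadj (parcs H) V W"
    and edge: "x \<in> W - {v}" "y \<in> W - {v}" "(x, y) \<in> parcs H"
  shows False
proof -
  let ?E = "parcs H"
  have sym: "sym ?E" and irr: "irrefl ?E" and fin: "finite (V \<union> W)"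
    using pg[OF H] V(1) by (auto simp: pair_graph_iff)
  obtain U D n N' where UD: "W - {v} = U \<union> D" and xy: "x \<in> D" "y \<in> D"
    and N: "N = add_mset n N'" and U: "pieces ?E U N'" and D: "finite D" "card D \<le> n" "nonadj ?E U D"
    using pieces_split_edge[OF V(3) edge] by metis
  have "x \<noteq> y" using edge(3) irr by (auto simp: irrefl_def)
  have card_D: "card (D - {z}) \<le> n - 1" if "z \<in> D" for z
    using D(1,2) that by (simp add: card_Diff_singleton)
  \<comment> \<open>Positivity makes \<open>n - 1\<close> a strict decrease.\<close>
  have "n > 0" using D(1,2) xy(1) card_gt_0_iff[of D] by fastforce
  have v: "v \<in> W"
  proof (rule ccontr)
    assume "v \<notin> W"
    \<comment> \<open>If \<open>v\<close> is outside \<open>W\<close>, the deletion was wasted: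
      deleting \<open>x\<close> instead gives \<open>H\<close> itself a smaller measure.\<close>
    have "pieces ?E (U \<union> (D - {x})) (add_mset (n - 1) N')"
      using U D card_D[OF xy(1)] by (intro pieces.add) (auto simp: nonadj_def)
    then have "pieces ?E (W - {x}) (add_mset (n - 1) N')"
      by (rule pieces_subset) (use UD \<open>v \<notin> W\<close> in blast)
    then have "centred_parts ?E (V \<union> W) (add_mset (add_mset (n - 1) N') M)"
      using V by (intro centred_parts.add)
    moreover have "add_mset (add_mset (n - 1) N') M < add_mset N M"
      unfolding N using \<open>n > 0\<close> by (intro add_mset_lt_left_lt) simp
    ultimately show False using least[OF H] V(1) by simp
  qed
  then have W: "W = insert v (U \<union> D)" using UD by auto

  \<comment> \<open>Index \<open>0\<close> marks the vertices outside the copies of \<open>D\<close>.\<close>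
  define EE where "EE = {((a, i), (b, j)) | a b i j. (a, b) \<in> ?E \<and> (i = j \<or> i = 0 \<or> j = (0::nat))}"
  have EE: "((a, i), (b, j)) \<in> EE \<longleftrightarrow> (a, b) \<in> ?E \<and> (i = j \<or> i = 0 \<or> j = 0)" for a b i j
    by (auto simp: EE_def)
  have EE_fst: "(fst p, fst q) \<in> ?E" if "(p, q) \<in> EE" for p q
    using that by (auto simp: EE_def)
  have symEE: "sym EE" using sym by (auto simp: EE_def sym_def)
  have irrEE: "irrefl EE" using irr by (auto simp: EE_def irrefl_def)
  have avoids: "avoids \<F> EE A" if "centred_parts EE A M'" "M' < add_mset N M" for A M'
    unfolding avoids_def using centred_parts_embeds[OF that(1)] least that(2) by blast
  have nonadjEE: "nonadj EE P Q" if "nonadj ?E (fst ` P) (fst ` Q)" for P Q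
    unfolding nonadj_def
  proof (intro ballI conjI notI)
    fix p q assume "p \<in> P" "q \<in> Q"
    then have "fst p \<in> fst ` P" "fst q \<in> fst ` Q" by auto
    with that have "(fst p, fst q) \<notin> ?E" "(fst q, fst p) \<notin> ?E" unfolding nonadj_def by blast+
    then show "(p, q) \<in> EE \<Longrightarrow> False" "(q, p) \<in> EE \<Longrightarrow> False" using EE_fst by auto
  qed
  \<comment> \<open>The indices differ and are both positive, so \<open>EE\<close> has no arc here,
    even where \<open>?E\<close> has one.\<close>
  have copies: "nonadj EE (P \<times> {i}) (Q \<times> {j})"
    if "P \<subseteq> D" "Q \<subseteq> D" "i \<in> {1..k}" "j \<in> {1..k}" "i \<noteq> j" for P Q i j and k :: nat
    using that by (auto simp: nonadj_def EE)

  \<comment> \<open>The host \<open>X k\<close> attaches \<open>k\<close> copies of \<open>D\<close>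
    to one copy of \<open>B\<close>. A set \<open>I\<close> encodes which of \<open>x\<close> and
    \<open>y\<close> is missing from each copy.\<close>
  define B where "B = V \<union> insert v U"
  define X where "X k = B \<times> {0} \<union> D \<times> {1..k}" for k :: nat
  define A where "A k I = B \<times> {0} \<union> (\<Union>i\<in>{1..k}. (D - {if i \<in> I then x else y}) \<times> {i})"
    for k :: nat and I :: "nat set"
  have V0: "centred_parts EE (V \<times> {0}) M"
    by (rule centred_parts_pullback[OF V(2), of fst]) (auto simp: inj_on_def EE_def)
  have U0: "pieces EE (U \<times> {0}) N'"
    by (rule pieces_pullback[OF U, of fst]) (auto simp: inj_on_def EE_def)

  have avoids_A: "avoids \<F> EE (A k I)" for k I
  proof -
    let ?Z = "\<lambda>i. (D - {if i \<in> I then x else y}) \<times> {i}"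
    let ?P = "U \<times> {0} \<union> (\<Union>i\<in>{1..k}. ?Z i)"
    \<comment> \<open>With \<open>v\<close> still the deleted vertex of this part, the one piece of
      bound \<open>n\<close> becomes \<open>k\<close> pieces of bound \<open>n - 1\<close>; the
      inner multiset, hence the outer one, decreases.\<close>
    have "pieces EE ?P (N' + replicate_mset (card {1..k}) (n - 1))"
    proof (rule pieces_Un_copies[OF U0])
      show "finite (?Z i)" for i using D(1) by auto
      show "card (?Z i) \<le> n - 1" for i
        using card_D[of "if i \<in> I then x else y"] xy by (auto simp: card_cartesian_product)
      show "nonadj EE (U \<times> {0}) (?Z i)" for i
        by (rule nonadjEE) (use D(3) in \<open>auto simp: nonadj_def\<close>)
      show "nonadj EE (?Z i) (?Z j)" if "i \<in> {1..k}" "j \<in> {1..k}" "i \<noteq> j" for i j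
        using that by (intro copies[where k = k]) auto
    qed simp
    then have "pieces EE (insert (v, 0) ?P - {(v, 0)}) (N' + replicate_mset (card {1..k}) (n - 1))"
      by (rule pieces_subset) auto
    then have "centred_parts EE (V \<times> {0} \<union> insert (v, 0) ?P)
        (add_mset (N' + replicate_mset (card {1..k}) (n - 1)) M)"
      by (rule centred_parts.add[OF V0])
        (rule nonadjEE, use V(4) W in \<open>auto simp: nonadj_def split: if_splits\<close>)
    moreover have "V \<times> {0} \<union> insert (v, 0) ?P = A k I" by (auto simp: A_def B_def)
    moreover have "N' + replicate_mset (card {1..k}) (n - 1) < N' + {#n#}"
      using \<open>n > 0\<close> by (intro add_strict_left_mono replicate_mset_less_single) simp
    ultimately show ?thesis using avoids add_mset_lt_left_lt[of _ N M] by (simp add: N)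
  qed

  have avoids_X: "avoids \<F> EE (X k - {(v, 0)})" for k
  proof -
    \<comment> \<open>Once \<open>v\<close> is gone, \<open>U\<close> and the copies of
      \<open>D\<close> are mutually nonadjacent and become parts of their own. The part from
      \<open>U\<close> gets \<open>(v, 0)\<close> as deleted vertex, which lies outside
      \<open>U \<times> {0}\<close>.\<close>
    have VU: "centred_parts EE (V \<times> {0} \<union> U \<times> {0}) (add_mset N' M)"
      by (intro centred_parts.add[OF V0, of _ "(v, 0)"] pieces_subset[OF U0] nonadjEE)
        (use V(4) W in \<open>auto simp: nonadj_def\<close>)
    have all: "centred_parts EE ((V \<times> {0} \<union> U \<times> {0}) \<union> (\<Union>i\<in>{1..k}. D \<times> {i}))
        (add_mset N' M + replicate_mset (card {1..k}) {#n - 1#})"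
    proof (rule centred_parts_Un_copies[OF VU])
      show "pieces EE (D \<times> {i} - {(x, i)}) {#n - 1#}" for i
      proof -
        have "D \<times> {i} - {(x, i)} = (D - {x}) \<times> {i}" by auto
        then show ?thesis
          using D(1) card_D[OF xy(1)] by (simp add: pieces_single card_cartesian_product)
      qed
      show "nonadj EE (V \<times> {0} \<union> U \<times> {0}) (D \<times> {i})" for i
        by (rule nonadjEE) (use D(3) V(4) W in \<open>auto simp: nonadj_def\<close>)
      show "nonadj EE (D \<times> {i}) (D \<times> {j})" if "i \<in> {1..k}" "j \<in> {1..k}" "i \<noteq> j" for i j
        using that by (intro copies[where k = k]) auto
    qed simp
    have "X k - {(v, 0)} \<subseteq> (V \<times> {0} \<union> U \<times> {0}) \<union> (\<Union>i\<in>{1..k}. D \<times> {i})"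
      by (auto simp: X_def B_def)
    from centred_parts_subset[OF all this]
    have "centred_parts EE (X k - {(v, 0)}) (M + add_mset N' (replicate_mset k {#n - 1#}))"
      by (simp add: ac_simps)
    \<comment> \<open>The multiset \<open>N\<close> is replaced by \<open>N'\<close> and
      \<open>k\<close> times \<open>{#n - 1#}\<close>, all of which are smaller than
      \<open>N\<close>.\<close>
    moreover have "M + add_mset N' (replicate_mset k {#n - 1#}) < M + {#N#}"
    proof (rule add_strict_left_mono)
      have "{#n - 1#} < {#n#}" using \<open>n > 0\<close> by simp
      also have "{#n#} \<le> N" by (simp add: N)
      finally have "{#n - 1#} < N" .
      moreover have "N' < N" unfolding N by (rule le_multiset_right_total)
      ultimately show "add_mset N' (replicate_mset k {#n - 1#}) < {#N#}"
        by (auto simp: in_replicate_mset)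
    qed
    ultimately show ?thesis using avoids by simp
  qed

  have contains: "\<not> avoids \<F> EE Y" if "B \<times> {0} \<union> D \<times> {i} \<subseteq> Y" for i Y
  proof -
    \<comment> \<open>Vertices of \<open>D\<close> go to copy \<open>i\<close>, all others to index
      0. Arcs agree because two of these indices differ only when one is 0.\<close>
    let ?f = "\<lambda>u. (u, if u \<in> D then i else 0)"
    have "embeds H EE Y"
      unfolding embeds_def
    proof (intro exI[of _ ?f] conjI ballI)
      show "inj_on ?f (pverts H)" by (auto simp: inj_on_def)
      show "?f ` pverts H \<subseteq> Y" using that V(1) W by (auto simp: B_def)
    qed (auto simp: EE)
    then show ?thesis using H unfolding avoids_def by blast
  qed

  have union: "\<not> avoids \<F> EE (A k I \<union> A k J)" if IJ: "I \<subseteq> {1..k}" "J \<subseteq> {1..k}" "I \<noteq> J" for k I J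
  proof -
    \<comment> \<open>In copy \<open>i\<close> one set lacks only \<open>x\<close> and the other
      only \<open>y\<close>, so the union has the full copy.\<close>
    obtain i where i: "i \<in> {1..k}" "i \<in> I \<longleftrightarrow> i \<notin> J" using IJ by blast
    have "B \<times> {0} \<union> D \<times> {i} \<subseteq> A k I \<union> A k J"
      using i \<open>x \<noteq> y\<close> by (cases "i \<in> I") (auto simp: A_def)
    then show ?thesis by (rule contains)
  qed
  from CKS_property_bound_any_type[OF CKS pg]
  obtain p :: "real poly" where p: "\<forall>(V :: ('a \<times> nat) set) E v \<A>. finite V \<longrightarrow> sym E \<longrightarrow>
      irrefl E \<longrightarrow> v \<in> V \<longrightarrow> avoids \<F> E (V - {v}) \<longrightarrow> \<not> avoids \<F> E V \<longrightarrow>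
      incompatible \<F> E V \<A> \<longrightarrow> real (card \<A>) \<le> poly p (real (card V))"
    by (rule exE)
  obtain k where k: "k \<ge> 1" "poly p (real (card B + k * card D)) < 2 ^ k"
    using ex_poly_less_power2 by blast
  have finB: "finite B" using fin W by (simp add: B_def)
  \<comment> \<open>If two index sets gave the same set, its union with itself would avoid \<F>,
    against \<open>union\<close>.\<close>
  have "inj_on (A k) (Pow {1..k})"
  proof (rule inj_onI, rule ccontr)
    fix I J assume "I \<in> Pow {1..k}" "J \<in> Pow {1..k}" "A k I = A k J" "I \<noteq> J"
    with union[of I k J] avoids_A[of k I] show False by simp
  qed
  then have "card (A k ` Pow {1..k}) = 2 ^ k" by (simp add: card_image card_Pow)
  moreover have "card (X k) = card B + k * card D"
  proof -
    have "card (X k) = card (B \<times> {0::nat}) + card (D \<times> {1..k})"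
      unfolding X_def using finB D(1) by (intro card_Un_disjoint) auto
    then show ?thesis by (simp add: card_cartesian_product)
  qed
  moreover have "real (card (A k ` Pow {1..k})) \<le> poly p (real (card (X k)))"
  proof (rule p[rule_format, OF _ symEE irrEE _ avoids_X])
    show "finite (X k)" using finB D(1) by (simp add: X_def)
    show "(v, 0) \<in> X k" by (simp add: X_def B_def)
    show "\<not> avoids \<F> EE (X k)" by (rule contains[of 1]) (use k(1) in \<open>auto simp: X_def\<close>)
    show "incompatible \<F> EE (X k) (A k ` Pow {1..k})"
      unfolding incompatible_def
    proof (intro conjI ballI impI)
      show "A k ` Pow {1..k} \<subseteq> Pow (X k)" by (auto simp: A_def X_def)
      show "avoids \<F> EE Y" if "Y \<in> A k ` Pow {1..k}" for Y using that avoids_A by auto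
      show "\<not> avoids \<F> EE (Y \<union> Z)"
        if "Y \<in> A k ` Pow {1..k}" "Z \<in> A k ` Pow {1..k}" "Y \<noteq> Z" for Y Z
        using that union by auto
    qed
  qed
  ultimately show False using k(2) by simp
qed

section \<open>Choice of a member with least measure\<close>

lemma ex_star_forest:
  assumes "\<F> \<noteq> {}" and pg: "\<And>H. H \<in> \<F> \<Longrightarrow> pair_graph H" and CKS: "CKS_property (free_graphs \<F>)"
  shows "\<exists>H\<in>\<F>. star_forest H"
proof (rule ccontr)
  assume none: "\<not> (\<exists>H\<in>\<F>. star_forest H)"
  \<comment> \<open>All covers of all members of \<F> compete. Multisets of multisets of naturals
    are well-ordered, so \<open>LEAST\<close> is attained.\<close>
  define P where "P M \<longleftrightarrow> (\<exists>H\<in>\<F>. centred_parts (parcs H) (pverts H) M)" for M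
  have "\<exists>M. P M"
    using assms(1) centred_parts_trivial pg unfolding P_def pair_graph_iff by blast
  then have "P (LEAST M. P M)" by (rule LeastI_ex)
  then obtain H where H: "H \<in> \<F>" "centred_parts (parcs H) (pverts H) (LEAST M. P M)"
    unfolding P_def by blast
  have least: "\<not> M' < (LEAST M. P M)" if "H' \<in> \<F>" "centred_parts (parcs H') (pverts H') M'" for H' M'
    using that not_less_Least unfolding P_def by blast
  show False
    using H(2)
  proof (cases rule: centred_parts_cases)
    case (edge V W v N M x y)
    show False
      by (rule minimal_not_star_forest_False[OF pg CKS H(1) _ edge(1,3,4,5,6,7,8)])
        (use least edge(2) in auto)
  next
    case starry
    then have "star_forest H" using pg[OF H(1)] star_forestI by blast
    with none H(1) show False by blast
  qed
qed

theorem theorem1p7: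
  fixes \<F> :: "'a pair_pre_digraph set"
  assumes "\<F> \<noteq> {}"
    and "\<And>H. H \<in> \<F> \<Longrightarrow> pair_graph H"
    and "CKS_property (free_graphs \<F>)"
  shows "(\<exists>H \<in> \<F>. star_forest H) \<and>
         (\<exists>H \<in> \<F>. \<exists>S. star_forest S \<and> H = pair_complement S)"
proof
  show "\<exists>H \<in> \<F>. star_forest H" using assms by (rule ex_star_forest)
  have "\<exists>S\<in>pair_complement ` \<F>. star_forest S"
    using assms by (intro ex_star_forest CKS_property_complement) (auto intro: pair_graph_complement)
  then obtain H where "H \<in> \<F>" "star_forest (pair_complement H)" by blast
  moreover from this have "H = pair_complement (pair_complement H)"
    using assms(2) by (simp add: pair_complement_complement)
  ultimately show "\<exists>H \<in> \<F>. \<exists>S. star_forest S \<and> H = pair_complement S" by blast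
qed

end
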